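(* For all $n\geq1$ and all $k\geq1$ (natural number) or $k=\mathbb{N}$: $\widehat{\mathrm{RT}_{n,k}}\leq_{sW}\mathrm{RT}_{n+2,2}$ and $\widehat{\mathrm{SRT}_{n,k}}\leq_{sW}\mathrm{SRT}_{n+2,2}$.
   Context: Weihrauch framework. A represented space is a set $X$ with a surjective partial map $\delta_X:\subseteq\mathbb{N}^{\mathbb{N}}\to X$. A problem is a partial multi-valued function $f:\subseteq X\rightrightarrows Y$; a partial $F:\subseteq\mathbb{N}^{\mathbb{N}}\to\mathbb{N}^{\mathbb{N}}$ realizes $f$ if $\delta_Y(F(p))\in f(\delta_X(p))$ whenever $\delta_X(p)\in\mathrm{dom}(f)$. $f\leq_{sW}g$ means there are computable partial $H,K:\subseteq\mathbb{N}^{\mathbb{N}}\to\mathbb{N}^{\mathbb{N}}$ with $H\circ G\circ K$ realizing $f$ for every realizer $G$ of $g$. The parallelization $\widehat{f}:\subseteq X^{\mathbb{N}}\rightrightarrows Y^{\mathbb{N}}$ maps $(x_i)_i$ (with all $x_i\in\mathrm{dom}(f)$) to $\prod_i f(x_i)$, sequences being represented by $\langle p_0,p_1,\dots\rangle$ with $\langle p_0,p_1,\dots\rangle\langle n,j\rangle=p_n(j)$ for a standard pairing $\langle n,j\rangle$. Ramsey. $[\mathbb{N}]^n$ is the set of $n$-element subsets of $\mathbb{N}$; $k$ is identified with $\{0,\dots,k-1\}$. $\mathcal{C}_{n,k}$ ($k\in\mathbb{N}$) is the set of colorings $c:[\mathbb{N}]^n\to k$ and $\mathcal{C}_{n,\mathbb{N}}$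 the set of $c:[\mathbb{N}]^n\to\mathbb{N}$ with finite range, represented by names $p$ with $p(i)=c(\vartheta_n(i))$ for a fixed standard computable bijection $\vartheta_n:\mathbb{N}\to[\mathbb{N}]^n$. $M$ is homogeneous for $c$ if $c$ is constant on $[M]^n$. $c$ is stable if $\lim_{i\to\infty}c(A\cup\{i\})$ exists for all $A\in[\mathbb{N}]^{n-1}$. $\mathrm{RT}_{n,k}:\mathcal{C}_{n,k}\rightrightarrows2^{\mathbb{N}}$ maps $c$ to the set of characteristic functions of infinite homogeneous sets for $c$; $\mathrm{SRT}_{n,k}$ is its restriction to stable colorings. *)

theory Defs
  imports Complex_Main "HOL-Library.Nat_Bijection" "HOL-Library.FuncSet"
    "HOL-Library.Ramsey" "HOL-Library.Extended_Nat" "HOL-Library.Indicator_Function"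
begin

section \<open>Computability on Baire space\<close>

type_synonym baire = "nat \<Rightarrow> nat"

definition minimize :: "(nat \<rightharpoonup> nat) \<Rightarrow> nat option" where
  "minimize h =
    (let least_zero = (\<lambda>n. h n = Some 0 \<and> (\<forall>m<n. \<exists>v. h m = Some (Suc v)))
     in if \<exists>n. least_zero n then Some (THE n. least_zero n) else None)"

text \<open>
  Kleene's partial recursive functionals \<open>F(p, x)\<close> of a function argument \<open>p\<close> (the oracle) and a
  number argument \<open>x\<close>. Several number arguments are coded into one by Cantor pairing, so the
  projections and pairing replace the usual families of arities; in primitive recursion \<open>x\<close>
  codes \<open>(a, n)\<close> with parameter \<open>a\<close> and recursion variable \<open>n\<close>. The construction is uniform in
  \<open>p\<close>: one functional describes the behaviour of one oracle program on all oracles.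
\<close>

inductive partial_recursive :: "(baire \<Rightarrow> nat \<rightharpoonup> nat) \<Rightarrow> bool" where
  pr_zero: "partial_recursive (\<lambda>p x. Some 0)"
| pr_suc: "partial_recursive (\<lambda>p x. Some (Suc x))"
| pr_fst: "partial_recursive (\<lambda>p x. Some (fst (prod_decode x)))"
| pr_snd: "partial_recursive (\<lambda>p x. Some (snd (prod_decode x)))"
| pr_oracle: "partial_recursive (\<lambda>p x. Some (p x))"
| pr_pair: "partial_recursive f \<Longrightarrow> partial_recursive g \<Longrightarrow>
    partial_recursive (\<lambda>p x. Option.bind (f p x) (\<lambda>u. Option.bind (g p x) (\<lambda>v.
      Some (prod_encode (u, v)))))"
| pr_comp: "partial_recursive f \<Longrightarrow> partial_recursive g \<Longrightarrow>
    partial_recursive (\<lambda>p. f p \<circ>\<^sub>m g p)"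
| pr_primrec: "partial_recursive f \<Longrightarrow> partial_recursive g \<Longrightarrow>
    partial_recursive (\<lambda>p x. case prod_decode x of (a, n) \<Rightarrow>
      rec_nat (f p a)
        (\<lambda>m r. Option.bind r (\<lambda>v. g p (prod_encode (a, prod_encode (m, v))))) n)"
| pr_minimize: "partial_recursive f \<Longrightarrow>
    partial_recursive (\<lambda>p x. minimize (\<lambda>n. f p (prod_encode (x, n))))"

text \<open>
  As usual in the Weihrauch framework, nothing is required of the program on oracles outside
  the domain of \<open>F\<close>.
\<close>

definition computable :: "(baire \<rightharpoonup> baire) \<Rightarrow> bool" where
  "computable F \<longleftrightarrow>
    (\<exists>f. partial_recursive f \<and> (\<forall>p q. F p = Some q \<longrightarrow> (\<forall>i. f p i = Some (q i))))"


section \<open>Represented spaces, problems and strong Weihrauch reducibility\<close>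

text \<open>
  A representation is a partial map out of Baire space. The represented space is its range
  \<open>ran \<delta>\<close>, so that surjectivity is built in.
\<close>

type_synonym 'x representation = "baire \<rightharpoonup> 'x"

record ('x, 'y) problem =
  in_rep :: "'x representation"
  out_rep :: "'y representation"
  solutions :: "'x \<Rightarrow> 'y set"

text \<open>A multi-valued map is given by its values; it is undefined where the value is empty.\<close>

definition problem_dom :: "('x, 'y) problem \<Rightarrow> 'x set" where
  "problem_dom f = {x. solutions f x \<noteq> {}}"

definition realizes :: "(baire \<rightharpoonup> baire) \<Rightarrow> ('x, 'y) problem \<Rightarrow> bool" where
  "realizes F f \<longleftrightarrow>
    (\<forall>p x. in_rep f p = Some x \<and> x \<in> problem_dom f \<longrightarrow>
      (\<exists>q y. F p = Some q \<and> out_rep f q = Some y \<and> y \<in> solutions f x))"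

definition strong_weihrauch_le ::
    "('x, 'y) problem \<Rightarrow> ('u, 'v) problem \<Rightarrow> bool" (infix "\<le>\<^sub>s\<^sub>W" 50) where
  "f \<le>\<^sub>s\<^sub>W g \<longleftrightarrow>
    (\<exists>H K. computable H \<and> computable K \<and>
      (\<forall>G. realizes G g \<longrightarrow> realizes (H \<circ>\<^sub>m G \<circ>\<^sub>m K) f))"

definition seq_rep :: "'x representation \<Rightarrow> (nat \<Rightarrow> 'x) representation" where
  "seq_rep \<delta> p =
    (if \<forall>n. (\<lambda>j. p (prod_encode (n, j))) \<in> dom \<delta>
     then Some (\<lambda>n. the (\<delta> (\<lambda>j. p (prod_encode (n, j)))))
     else None)"

text \<open>
  The value below is nonempty iff every \<open>xs i\<close> lies in the domain of \<open>f\<close>.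
\<close>

definition parallelization ::
    "('x, 'y) problem \<Rightarrow> (nat \<Rightarrow> 'x, nat \<Rightarrow> 'y) problem" where
  "parallelization f =
    \<lparr>in_rep = seq_rep (in_rep f), out_rep = seq_rep (out_rep f),
     solutions = (\<lambda>xs. {ys. \<forall>i. ys i \<in> solutions f (xs i)})\<rparr>"

lemma ran_seq_rep: "ran (seq_rep \<delta>) = {xs. \<forall>n. xs n \<in> ran \<delta>}"
proof (intro equalityI subsetI)
  fix xs :: "nat \<Rightarrow> _" assume "xs \<in> ran (seq_rep \<delta>)"
  then obtain p where "seq_rep \<delta> p = Some xs"
    by (auto simp: ran_def)
  then have "\<forall>n. \<delta> (\<lambda>j. p (prod_encode (n, j))) = Some (xs n)"
    by (auto simp: seq_rep_def dom_def split: if_splits)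
  then show "xs \<in> {xs. \<forall>n. xs n \<in> ran \<delta>}"
    by (auto intro: ranI)
next
  fix xs :: "nat \<Rightarrow> 'a" assume "xs \<in> {xs. \<forall>n. xs n \<in> ran \<delta>}"
  then have "\<forall>n. \<exists>q. \<delta> q = Some (xs n)"
    by (auto simp: ran_def)
  then obtain q where q: "\<And>n::nat. \<delta> (q n) = Some (xs n)"
    by metis
  define p where "p = (\<lambda>x. case prod_decode x of (n, j) \<Rightarrow> q n j)"
  have "(\<lambda>j. p (prod_encode (n, j))) = q n" for n
    by (simp add: p_def)
  then have "seq_rep \<delta> p = Some xs"
    by (auto simp: seq_rep_def q)
  then show "xs \<in> ran (seq_rep \<delta>)"
    by (auto simp: ran_def)
qed

lemma problem_dom_parallelization:
  "problem_dom (parallelization f) = {xs. \<forall>i. xs i \<in> problem_dom f}"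
proof (intro equalityI subsetI)
  fix xs :: "nat \<Rightarrow> _" assume "xs \<in> {xs. \<forall>i. xs i \<in> problem_dom f}"
  then have "\<forall>i. \<exists>y. y \<in> solutions f (xs i)"
    by (auto simp: problem_dom_def)
  then show "xs \<in> problem_dom (parallelization f)"
    by (auto simp: problem_dom_def parallelization_def dest: choice)
qed (auto simp: problem_dom_def parallelization_def)


section \<open>Ramsey's theorem as a problem\<close>

text \<open>
  The enumeration of the \<open>n\<close>-element sets: the number coding the tuple \<open>(i\<^sub>0, \<dots>, i\<^sub>n\<^sub>-\<^sub>1)\<close>
  by iterated pairing is sent to \<open>{k\<^sub>0 < \<dots> < k\<^sub>n\<^sub>-\<^sub>1}\<close> where \<open>k\<^sub>j = j + i\<^sub>0 + \<dots> + i\<^sub>j\<close>. It is a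
  bijection for \<open>n \<ge> 1\<close>.
\<close>

fun theta :: "nat \<Rightarrow> nat \<Rightarrow> nat set" where
  "theta 0 s = {}"
| "theta (Suc 0) s = {s}"
| "theta (Suc (Suc n)) s =
    (case prod_decode s of (i, t) \<Rightarrow> insert i ((\<lambda>x. Suc (i + x)) ` theta (Suc n) t))"

lemma theta_nsets: "theta n s \<in> [UNIV]\<^bsup>n\<^esup>"
proof (induction n s rule: theta.induct)
  case (3 n s)
  obtain i t where it: "prod_decode s = (i, t)"
    by fastforce
  have IH: "finite (theta (Suc n) t)" "card (theta (Suc n) t) = Suc n"
    using 3 it by (auto simp: nsets_def)
  have "card ((\<lambda>x. Suc (i + x)) ` theta (Suc n) t) = Suc n"
    using IH by (subst card_image) (auto simp: inj_on_def)
  moreover have "i \<notin> (\<lambda>x. Suc (i + x)) ` theta (Suc n) t"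
    by auto
  ultimately show ?case
    using IH by (simp add: nsets_def it)
qed (auto simp: nsets_def)

lemma theta_inj: "theta (Suc n) s = theta (Suc n) s' \<Longrightarrow> s = s'"
proof (induction n arbitrary: s s')
  case (Suc n)
  obtain i t i' t' where it: "prod_decode s = (i, t)" "prod_decode s' = (i', t')"
    by fastforce
  have eq: "insert i ((\<lambda>x. Suc (i + x)) ` theta (Suc n) t)
          = insert i' ((\<lambda>x. Suc (i' + x)) ` theta (Suc n) t')" (is "insert i ?A = insert i' ?A'")
    using Suc.prems by (simp add: it)
  have "i \<in> insert i' ?A'" "i' \<in> insert i ?A"
    using eq by auto
  then have "i' \<le> i" "i \<le> i'"
    by auto
  then have ii: "i' = i"
    by simp
  have "i \<notin> ?A" "i \<notin> ?A'"
    using ii by auto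
  then have "?A = ?A'"
    using eq ii by (metis insert_ident)
  moreover have "inj (\<lambda>x. Suc (i + x))"
    by (auto simp: inj_on_def)
  ultimately have "theta (Suc n) t = theta (Suc n) t'"
    using ii by (simp add: inj_image_eq_iff)
  then have "prod_decode s = prod_decode s'"
    using Suc.IH it ii by auto
  then show ?case
    using prod_decode_inverse[of s] prod_decode_inverse[of s'] by simp
qed simp

lemma theta_surj: "A \<in> [UNIV]\<^bsup>Suc n\<^esup> \<Longrightarrow> \<exists>s. theta (Suc n) s = A"
proof (induction n arbitrary: A)
  case 0
  then show ?case
    by (auto simp: nsets_def card_1_singleton_iff)
next
  case (Suc n)
  have A: "finite A" "card A = Suc (Suc n)" "A \<noteq> {}"
    using Suc.prems by (auto simp: nsets_def)
  define i where "i = Min A"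
  define B where "B = (\<lambda>x. x - Suc i) ` (A - {i})"
  have "i \<in> A" "\<And>x. x \<in> A \<Longrightarrow> i \<le> x"
    using A by (simp_all add: i_def)
  then have i: "i \<in> A" "\<And>x. x \<in> A - {i} \<Longrightarrow> Suc i \<le> x"
    by (simp_all add: Suc_le_eq order_less_le)
  have "inj_on (\<lambda>x. x - Suc i) (A - {i})"
  proof (rule inj_onI)
    fix x y assume "x \<in> A - {i}" "y \<in> A - {i}" "x - Suc i = y - Suc i"
    then show "x = y"
      using i(2)[of x] i(2)[of y] by linarith
  qed
  then have "B \<in> [UNIV]\<^bsup>Suc n\<^esup>"
    using A i(1) by (simp add: B_def nsets_def card_image)
  then obtain t where t: "theta (Suc n) t = B"
    using Suc.IH by blast
  have "Suc (i + (x - Suc i)) = x" if "x \<in> A - {i}" for x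
    using i(2)[OF that] by simp
  then have "(\<lambda>x. Suc (i + x)) ` B = A - {i}"
    by (simp add: B_def image_image cong: image_cong_simp)
  then have "theta (Suc (Suc n)) (prod_encode (i, t)) = A"
    using i(1) t by (simp add: insert_absorb)
  then show ?case
    by blast
qed

lemma bij_betw_theta:
  assumes "n \<ge> 1"
  shows "bij_betw (theta n) UNIV ([UNIV]\<^bsup>n\<^esup>)"
proof -
  obtain m where n: "n = Suc m"
    using assms by (cases n) simp_all
  show ?thesis
    unfolding bij_betw_def n
  proof (intro conjI equalityI subsetI)
    show "inj (theta (Suc m))"
      by (intro injI theta_inj)
    show "A \<in> [UNIV]\<^bsup>Suc m\<^esup>" if "A \<in> range (theta (Suc m))" for A
      using that theta_nsets by blast
    show "A \<in> range (theta (Suc m))" if "A \<in> [UNIV]\<^bsup>Suc m\<^esup>" for A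
      using theta_surj[OF that] by blast
  qed
qed

text \<open>
  The number of colors \<open>k\<close> is an extended natural number; \<open>k = \<infinity>\<close> stands for the color set
  \<open>\<nat>\<close>, in which case finiteness of the range is a genuine condition. Colorings are
  extensional, i.e. \<open>undefined\<close> off the \<open>n\<close>-element sets.
\<close>

definition colorings :: "nat \<Rightarrow> enat \<Rightarrow> (nat set \<Rightarrow> nat) set" where
  "colorings n k = {c \<in> [UNIV]\<^bsup>n\<^esup> \<rightarrow>\<^sub>E {i. enat i < k}. finite (c ` [UNIV]\<^bsup>n\<^esup>)}"

definition coloring_rep :: "nat \<Rightarrow> enat \<Rightarrow> (nat set \<Rightarrow> nat) representation" where
  "coloring_rep n k p =
    (let named = (\<lambda>c. c \<in> colorings n k \<and> (\<forall>i. p i = c (theta n i)))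
     in if \<exists>c. named c then Some (THE c. named c) else None)"

lemma coloring_rep_eq_Some_iff:
  assumes "n \<ge> 1"
  shows "coloring_rep n k p = Some c \<longleftrightarrow> c \<in> colorings n k \<and> (\<forall>i. p i = c (theta n i))"
proof -
  have uniq: "c = d" if c: "c \<in> colorings n k" "\<forall>i. p i = c (theta n i)"
    and d: "d \<in> colorings n k" "\<forall>i. p i = d (theta n i)" for c d
  proof (rule PiE_ext)
    show "c \<in> [UNIV]\<^bsup>n\<^esup> \<rightarrow>\<^sub>E {i. enat i < k}" "d \<in> [UNIV]\<^bsup>n\<^esup> \<rightarrow>\<^sub>E {i. enat i < k}"
      using c d by (auto simp: colorings_def)
    fix A :: "nat set" assume "A \<in> [UNIV]\<^bsup>n\<^esup>"
    then obtain i where "A = theta n i"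
      using bij_betw_theta[OF assms] by (auto simp: bij_betw_def)
    then show "c A = d A"
      using c d by metis
  qed
  show ?thesis
  proof (cases "\<exists>d. d \<in> colorings n k \<and> (\<forall>i. p i = d (theta n i))")
    case True
    then obtain d where d: "d \<in> colorings n k" "\<forall>i. p i = d (theta n i)"
      by blast
    then have "(THE c. c \<in> colorings n k \<and> (\<forall>i. p i = c (theta n i))) = d"
      using uniq by (intro the_equality) blast+
    then have "coloring_rep n k p = Some d"
      using True by (simp add: coloring_rep_def Let_def)
    then show ?thesis
      using d uniq by auto
  next
    case False
    then have "coloring_rep n k p = None"
      by (simp only: coloring_rep_def Let_def if_False)
    then show ?thesis
      using False by auto
  qed
qed

lemma ran_coloring_rep:
  assumes "n \<ge> 1"
  shows "ran (coloring_rep n k) = colorings n k"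
  unfolding ran_def coloring_rep_eq_Some_iff[OF assms] by auto

definition cantor_rep :: "(nat \<Rightarrow> nat) representation" where
  "cantor_rep p = (if \<forall>i. p i < 2 then Some p else None)"

definition homogeneous :: "nat \<Rightarrow> (nat set \<Rightarrow> nat) \<Rightarrow> nat set \<Rightarrow> bool" where
  "homogeneous n c M \<longleftrightarrow> (\<exists>i. \<forall>A\<in>[M]\<^bsup>n\<^esup>. c A = i)"

text \<open>
  Convergence is in the discrete topology of \<open>nat\<close>; the finitely many \<open>i \<in> A\<close> are irrelevant.
\<close>

definition stable :: "nat \<Rightarrow> (nat set \<Rightarrow> nat) \<Rightarrow> bool" where
  "stable n c \<longleftrightarrow> (\<forall>A\<in>[UNIV]\<^bsup>(n - 1)\<^esup>. convergent (\<lambda>i. c (A \<union> {i})))"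

definition RT :: "nat \<Rightarrow> enat \<Rightarrow> (nat set \<Rightarrow> nat, nat \<Rightarrow> nat) problem" where
  "RT n k =
    \<lparr>in_rep = coloring_rep n k, out_rep = cantor_rep,
     solutions = (\<lambda>c. if c \<in> colorings n k
       then {indicator M |M. infinite M \<and> homogeneous n c M} else {})\<rparr>"

definition SRT :: "nat \<Rightarrow> enat \<Rightarrow> (nat set \<Rightarrow> nat, nat \<Rightarrow> nat) problem" where
  "SRT n k = (RT n k)\<lparr>solutions := (\<lambda>c. if stable n c then solutions (RT n k) c else {})\<rparr>"

end

theory Submission imports Defs begin

text \<open>
  Given colorings \<open>c\<^sub>0, c\<^sub>1, \<dots>\<close> of the \<open>n\<close>-element sets, color an \<open>(n + 2)\<close>-element set \<open>B\<close> with
  minimum \<open>m\<close> by \<open>0\<close> iff \<open>B - {m}\<close> is homogeneous for each of \<open>c\<^sub>0, \<dots>, c\<^sub>m\<close>. Applying Ramsey's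
  theorem to \<open>c\<^sub>0, \<dots>, c\<^sub>m\<close> inside an infinite homogeneous set \<open>M\<close> rules out color \<open>1\<close>; hence for
  \<open>j \<le> m \<in> M\<close> all \<open>(n + 1)\<close>-element subsets of \<open>M \<inter> {m<..}\<close> are homogeneous for \<open>c\<^sub>j\<close>, and since any
  two \<open>n\<close>-element sets are linked by exchanging one element at a time, so is \<open>M \<inter> {m<..}\<close> itself.
  Taking the least such \<open>m\<close> for each \<open>j\<close> gives a solution sequence computable from \<open>M\<close> alone. The
  minimum bounds how many colorings matter, so the new coloring is computable, and stable if all
  the \<open>c\<^sub>j\<close> are.
\<close>

section \<open>Total recursive functionals\<close>

text \<open>Both reduction maps will be defined on all oracles, so the option values can be hidden
  from here on.\<close>

definition total_recursive :: "(baire \<Rightarrow> nat \<Rightarrow> nat) \<Rightarrow> bool" where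
  "total_recursive f \<longleftrightarrow> partial_recursive (\<lambda>p x. Some (f p x))"

definition recursive_pred :: "(baire \<Rightarrow> nat \<Rightarrow> bool) \<Rightarrow> bool" where
  "recursive_pred P \<longleftrightarrow> total_recursive (\<lambda>p x. of_bool (P p x))"

lemma total_recursive_comp:
  assumes "total_recursive f" "total_recursive g"
  shows "total_recursive (\<lambda>p x. f p (g p x))"
  using pr_comp[OF assms[unfolded total_recursive_def]]
  by (simp add: total_recursive_def map_comp_def)

lemma total_recursive_pair:
  assumes "total_recursive f" "total_recursive g"
  shows "total_recursive (\<lambda>p x. prod_encode (f p x, g p x))"
  using pr_pair[OF assms[unfolded total_recursive_def]]
  by (simp add: total_recursive_def)

lemma total_recursive_fst:
  "total_recursive f \<Longrightarrow> total_recursive (\<lambda>p x. fst (prod_decode (f p x)))"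
  by (rule total_recursive_comp[of "\<lambda>p x. fst (prod_decode x)"])
    (simp_all add: total_recursive_def pr_fst)

lemma total_recursive_snd:
  "total_recursive f \<Longrightarrow> total_recursive (\<lambda>p x. snd (prod_decode (f p x)))"
  by (rule total_recursive_comp[of "\<lambda>p x. snd (prod_decode x)"])
    (simp_all add: total_recursive_def pr_snd)

lemma total_recursive_oracle:
  "total_recursive f \<Longrightarrow> total_recursive (\<lambda>p x. p (f p x))"
  by (rule total_recursive_comp[of "\<lambda>p x. p x"]) (simp_all add: total_recursive_def pr_oracle)

lemma total_recursive_Suc:
  "total_recursive f \<Longrightarrow> total_recursive (\<lambda>p x. Suc (f p x))"
  by (rule total_recursive_comp[of "\<lambda>p x. Suc x"]) (simp_all add: total_recursive_def pr_suc)

lemma total_recursive_0: "total_recursive (\<lambda>p x. 0)"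
  by (simp add: total_recursive_def pr_zero)

lemma total_recursive_1: "total_recursive (\<lambda>p x. 1)"
  using total_recursive_Suc[OF total_recursive_0] by simp

lemma total_recursive_id: "total_recursive (\<lambda>p x. x)"
proof -
  have "total_recursive (\<lambda>p x. prod_encode (fst (prod_decode x), snd (prod_decode x)))"
    by (rule total_recursive_pair) (simp_all add: total_recursive_def pr_fst pr_snd)
  then show ?thesis
    by simp
qed

lemmas total_recursive_basic = total_recursive_id total_recursive_0 total_recursive_1
  total_recursive_Suc total_recursive_pair total_recursive_fst total_recursive_snd
  total_recursive_oracle

text \<open>The whole input \<open>x\<close> is the parameter of the recursion, so start value, step
  and number of rounds may all depend on it.\<close>

lemma total_recursive_rec_nat:
  assumes f: "total_recursive f" and N: "total_recursive N"
    and g: "total_recursive (\<lambda>p z. g p (fst (prod_decode z))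
      (fst (prod_decode (snd (prod_decode z)))) (snd (prod_decode (snd (prod_decode z)))))"
  shows "total_recursive (\<lambda>p x. rec_nat (f p x) (g p x) (N p x))"
proof -
  have rec: "rec_nat (Some (f p a)) (\<lambda>m r. Option.bind r (\<lambda>v. Some (g p a m v))) n
      = Some (rec_nat (f p a) (g p a) n)" for p a n
    by (induction n) simp_all
  have "total_recursive (\<lambda>p z. rec_nat (f p (fst (prod_decode z)))
      (g p (fst (prod_decode z))) (snd (prod_decode z)))"
    using pr_primrec[OF f[unfolded total_recursive_def] g[unfolded total_recursive_def]]
    by (simp add: total_recursive_def rec case_prod_unfold)
  from total_recursive_comp[OF this total_recursive_pair[OF total_recursive_id N]]
  show ?thesis
    by simp
qed

lemma total_recursive_If:
  assumes "recursive_pred P" "total_recursive f" "total_recursive g"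
  shows "total_recursive (\<lambda>p x. if P p x then f p x else g p x)"
proof -
  \<comment> \<open>Zero rounds leave \<open>g p x\<close>, a single round overwrites it by
    \<open>f p x\<close>.\<close>
  have "total_recursive (\<lambda>p x. rec_nat (g p x) (\<lambda>m v. f p x) (of_bool (P p x)))"
    using assms total_recursive_comp[OF assms(2) total_recursive_fst[OF total_recursive_id]]
    by (intro total_recursive_rec_nat) (simp_all add: recursive_pred_def)
  also have "(\<lambda>p x. rec_nat (g p x) (\<lambda>m v. f p x) (of_bool (P p x)))
      = (\<lambda>p x. if P p x then f p x else g p x)"
    by (auto simp: fun_eq_iff)
  finally show ?thesis .
qed

section \<open>Decidable predicates and arithmetic\<close>

lemma recursive_pred_not:
  assumes "recursive_pred P"
  shows "recursive_pred (\<lambda>p x. \<not> P p x)"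
proof -
  have "total_recursive (\<lambda>p x. if P p x then 0 else 1)"
    by (intro total_recursive_If assms total_recursive_basic)
  also have "(\<lambda>p x. if P p x then 0 else 1) = (\<lambda>p x. of_bool (\<not> P p x))"
    by (auto simp: fun_eq_iff)
  finally show ?thesis
    by (simp only: recursive_pred_def)
qed

lemma recursive_pred_conj:
  assumes "recursive_pred P" "recursive_pred Q"
  shows "recursive_pred (\<lambda>p x. P p x \<and> Q p x)"
proof -
  have "total_recursive (\<lambda>p x. if P p x then of_bool (Q p x) else 0)"
    using assms(2) by (intro total_recursive_If assms total_recursive_basic)
      (simp add: recursive_pred_def)
  also have "(\<lambda>p x. if P p x then of_bool (Q p x) else 0) = (\<lambda>p x. of_bool (P p x \<and> Q p x))"
    by (auto simp: fun_eq_iff)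
  finally show ?thesis
    by (simp only: recursive_pred_def)
qed

lemma recursive_pred_comp:
  "recursive_pred P \<Longrightarrow> total_recursive f \<Longrightarrow> recursive_pred (\<lambda>p x. P p (f p x))"
  using total_recursive_comp[of "\<lambda>p x. of_bool (P p x)" f] by (simp add: recursive_pred_def)

lemma recursive_pred_eq_0:
  assumes "total_recursive f"
  shows "recursive_pred (\<lambda>p x. f p x = 0)"
proof -
  have "total_recursive (\<lambda>p x. rec_nat 1 (\<lambda>m v. 0) (f p x))"
    by (intro total_recursive_rec_nat assms total_recursive_basic)
  also have "(\<lambda>p x. rec_nat 1 (\<lambda>m v. 0) (f p x)) = (\<lambda>p x. of_bool (f p x = 0))"
  proof (intro ext)
    show "rec_nat 1 (\<lambda>m v. 0) (f p x) = of_bool (f p x = 0)" for p x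
      by (cases "f p x") simp_all
  qed
  finally show ?thesis
    by (simp only: recursive_pred_def)
qed

lemma total_recursive_add:
  assumes "total_recursive f" "total_recursive g"
  shows "total_recursive (\<lambda>p x. f p x + g p x)"
proof -
  have "rec_nat a (\<lambda>m v. Suc v) b = a + b" for a b
    by (induction b) simp_all
  moreover have "total_recursive (\<lambda>p x. rec_nat (f p x) (\<lambda>m v. Suc v) (g p x))"
    by (intro total_recursive_rec_nat assms total_recursive_basic)
  ultimately show ?thesis
    by simp
qed

lemma total_recursive_diff:
  assumes "total_recursive f" "total_recursive g"
  shows "total_recursive (\<lambda>p x. f p x - g p x)"
proof -
  \<comment> \<open>The recursion variable itself yields the predecessor, whose iteration is
    truncated subtraction.\<close>
  have pred: "rec_nat 0 (\<lambda>m v. m) b = b - 1" for b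
    by (cases b) simp_all
  have "total_recursive (\<lambda>p x. rec_nat 0 (\<lambda>m v. m) x)"
    by (intro total_recursive_rec_nat total_recursive_basic)
  then have "total_recursive (\<lambda>p x. x - 1)"
    by (simp only: pred)
  then have "total_recursive (\<lambda>p z. snd (prod_decode (snd (prod_decode z))) - 1)"
    by (rule total_recursive_comp) (intro total_recursive_basic)
  then have "total_recursive (\<lambda>p x. rec_nat (f p x) (\<lambda>m v. v - 1) (g p x))"
    by (intro total_recursive_rec_nat assms)
  moreover have "rec_nat a (\<lambda>m v. v - 1) b = a - b" for a b :: nat
    by (induction b) simp_all
  ultimately show ?thesis
    by simp
qed

lemma recursive_pred_le:
  assumes "total_recursive f" "total_recursive g"
  shows "recursive_pred (\<lambda>p x. f p x \<le> g p x)"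
  using recursive_pred_eq_0[OF total_recursive_diff[OF assms]] by simp

lemma recursive_pred_eq:
  assumes "total_recursive f" "total_recursive g"
  shows "recursive_pred (\<lambda>p x. f p x = g p x)"
  using recursive_pred_conj[OF recursive_pred_le recursive_pred_le, OF assms assms(2,1)]
  by (simp add: eq_iff)

lemma recursive_pred_all_less:
  assumes "recursive_pred (\<lambda>p z. P p (fst (prod_decode z)) (snd (prod_decode z)))"
    and "total_recursive N"
  shows "recursive_pred (\<lambda>p x. \<forall>m<N p x. P p x m)"
proof -
  \<comment> \<open>The recursion step is evaluated at a code of \<open>(x, (m, v))\<close>, from
    which \<open>v\<close> is dropped.\<close>
  have "recursive_pred (\<lambda>p z. P p (fst (prod_decode z)) (fst (prod_decode (snd (prod_decode z)))))"
    using recursive_pred_comp[OF assms(1), of "\<lambda>p z. prod_encode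
      (fst (prod_decode z), fst (prod_decode (snd (prod_decode z))))"]
    by (simp add: total_recursive_basic)
  then have "total_recursive (\<lambda>p x. rec_nat 1 (\<lambda>m v. if P p x m then v else 0) (N p x))"
    by (intro total_recursive_rec_nat assms total_recursive_basic total_recursive_If)
  moreover have "rec_nat 1 (\<lambda>m v. if P p x m then v else 0) n = (of_bool (\<forall>m<n. P p x m) :: nat)"
    for p x n
    by (induction n) (auto simp: less_Suc_eq)
  ultimately show ?thesis
    by (simp only: recursive_pred_def)
qed

lemma recursive_pred_ex_less:
  assumes "recursive_pred (\<lambda>p z. P p (fst (prod_decode z)) (snd (prod_decode z)))"
    and "total_recursive N"
  shows "recursive_pred (\<lambda>p x. \<exists>m<N p x. P p x m)"
  using recursive_pred_not[OF recursive_pred_all_less[OF recursive_pred_not], OF assms] by simp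

text \<open>With \<open>N\<close> fixed the quantifier is a finite conjunction, so no uniformity in
  \<open>l\<close> is demanded. This suits \<open>del_code n l\<close>, which is shown recursive for
  each \<open>l\<close> separately.\<close>

lemma recursive_pred_all_const:
  assumes "\<And>l. recursive_pred (P l)"
  shows "recursive_pred (\<lambda>p x. \<forall>l<N::nat. P l p x)"
proof (induction N)
  case 0
  then show ?case
    using total_recursive_1 by (simp add: recursive_pred_def)
next
  case (Suc N)
  have "(\<forall>l<Suc N. P l p x) \<longleftrightarrow> P N p x \<and> (\<forall>l<N. P l p x)" for p x
    by (auto simp: less_Suc_eq)
  then show ?case
    using recursive_pred_conj[OF assms Suc.IH] by simp
qed

lemma computable_total: "total_recursive f \<Longrightarrow> computable (\<lambda>p. Some (f p))"
  unfolding computable_def total_recursive_def by auto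


section \<open>Deleting an element from a coded set\<close>

text \<open>
  Here \<open>s\<close> codes a set with \<open>n + 2\<close> elements, and \<open>l \<le> n + 1\<close> is the position, counted from \<open>0\<close> in
  increasing order, of the element to be deleted. As codes list gaps, deleting an element other
  than the last merges two neighbouring gaps.
\<close>

fun del_code :: "nat \<Rightarrow> nat \<Rightarrow> nat \<Rightarrow> nat" where
  "del_code 0 0 s = Suc (fst (prod_decode s) + snd (prod_decode s))"
| "del_code 0 (Suc l) s = fst (prod_decode s)"
| "del_code (Suc n) 0 s = prod_encode
    (Suc (fst (prod_decode s) + fst (prod_decode (snd (prod_decode s)))),
     snd (prod_decode (snd (prod_decode s))))"
| "del_code (Suc n) (Suc l) s = prod_encode
    (fst (prod_decode s), del_code n l (snd (prod_decode s)))"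

lemma total_recursive_del_code:
  "total_recursive f \<Longrightarrow> total_recursive (\<lambda>p x. del_code n l (f p x))"
proof (induction n arbitrary: l f)
  case 0
  then show ?case
    by (cases l) (simp_all add: total_recursive_basic total_recursive_add)
next
  case (Suc n)
  then show ?case
    by (cases l) (simp_all add: total_recursive_basic total_recursive_add)
qed

lemma theta_Suc_Suc:
  "theta (Suc (Suc n)) s =
    insert (fst (prod_decode s)) ((\<lambda>x. Suc (fst (prod_decode s) + x)) ` theta (Suc n) (snd (prod_decode s)))"
  by (simp add: case_prod_unfold)

declare theta.simps(3) [simp del]

text \<open>If the first two gaps are \<open>i\<close> and \<open>i'\<close>, the second element is
  \<open>Suc (i + i')\<close>, which is the first gap of the merged code. The case
  \<open>n = 0\<close> has its own clause in \<open>del_code\<close>, as the tail is then a bare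
  number.\<close>

lemma theta_del_code_0:
  "theta (Suc n) (del_code n 0 s) =
    (\<lambda>x. Suc (fst (prod_decode s) + x)) ` theta (Suc n) (snd (prod_decode s))"
  by (cases n) (simp_all add: theta_Suc_Suc image_image add.assoc)

lemma Min_theta: "Min (theta (Suc (Suc n)) s) = fst (prod_decode s)"
  using theta_nsets[of "Suc n" "snd (prod_decode s)"]
  by (intro Min_eqI) (auto simp: theta_Suc_Suc nsets_def)

lemma theta_minus_Min:
  "theta (Suc n) (del_code n 0 s) = theta (Suc (Suc n)) s - {Min (theta (Suc (Suc n)) s)}"
  unfolding theta_del_code_0 Min_theta by (auto simp: theta_Suc_Suc)

text \<open>Equating families of sets avoids tracking which element sits at which position.\<close>

lemma theta_del_code:
  "(\<lambda>l. theta (Suc n) (del_code n l s)) ` {..Suc n} =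
    (\<lambda>x. theta (Suc (Suc n)) s - {x}) ` theta (Suc (Suc n)) s"
proof (induction n arbitrary: s)
  case 0
  have "{..Suc 0} = {0, Suc 0}"
    by auto
  then show ?case
    by (simp add: theta_Suc_Suc insert_Diff_if insert_commute)
next
  case (Suc n)
  define i t where "i = fst (prod_decode s)" and "t = snd (prod_decode s)"
  define sh where "sh = (\<lambda>x. Suc (i + x))"
  define T where "T = theta (Suc (Suc n)) t"
  have s: "theta (Suc (Suc (Suc n))) s = insert i (sh ` T)"
    by (simp add: theta_Suc_Suc[of "Suc n"] i_def t_def sh_def T_def)
  have inj: "inj sh" and i: "i \<notin> sh ` X" for X
    by (auto simp: inj_on_def sh_def)
  \<comment> \<open>Position \<open>0\<close> leaves the shifted tail; each later position keeps
    \<open>i\<close> and deletes inside the tail.\<close>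
  have "(\<lambda>l. theta (Suc (Suc n)) (del_code (Suc n) l s)) ` {..Suc (Suc n)}
      = insert (sh ` T) ((\<lambda>l. insert i (sh ` theta (Suc n) (del_code n l t))) ` {..Suc n})"
    unfolding atMost_Suc_eq_insert_0[of "Suc n"] image_insert image_image
    by (simp only: theta_del_code_0) (simp add: theta_Suc_Suc[of n] i_def t_def sh_def T_def)
  also have "(\<lambda>l. insert i (sh ` theta (Suc n) (del_code n l t))) ` {..Suc n}
      = (\<lambda>X. insert i (sh ` X)) ` (\<lambda>l. theta (Suc n) (del_code n l t)) ` {..Suc n}"
    by (simp add: image_image)
  also have "\<dots> = (\<lambda>y. insert i (sh ` T) - {y}) ` sh ` T"
    unfolding Suc.IH T_def[symmetric] image_image
  proof (intro image_cong refl)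
    fix x
    have "sh ` (T - {x}) = sh ` T - {sh x}"
      using inj by (simp add: image_set_diff)
    moreover have "i \<noteq> sh x"
      by (simp add: sh_def)
    ultimately show "insert i (sh ` (T - {x})) = insert i (sh ` T) - {sh x}"
      by auto
  qed
  also have "insert (sh ` T) \<dots> = (\<lambda>y. insert i (sh ` T) - {y}) ` insert i (sh ` T)"
    using i by simp
  finally show ?case
    by (simp only: s)
qed

lemma nsets_card_Suc:
  assumes "finite A" "card A = Suc n"
  shows "[A]\<^bsup>n\<^esup> = (\<lambda>x. A - {x}) ` A"
proof (intro equalityI subsetI)
  fix S assume S: "S \<in> [A]\<^bsup>n\<^esup>"
  then have "card (A - S) = 1"
    using assms by (simp add: nsets_def card_Diff_subset)
  then obtain x where "A - S = {x}"
    by (auto simp: card_1_singleton_iff)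
  then show "S \<in> (\<lambda>x. A - {x}) ` A"
    using S by (intro image_eqI[of _ _ x]) (auto simp: nsets_def)
qed (use assms in \<open>auto simp: nsets_def\<close>)

lemma nsets_theta:
  "[theta (Suc (Suc n)) s]\<^bsup>Suc n\<^esup> = (\<lambda>l. theta (Suc n) (del_code n l s)) ` {..Suc n}"
  using theta_nsets[of "Suc (Suc n)" s]
  by (subst nsets_card_Suc) (simp_all only: theta_del_code nsets_def mem_Collect_eq)

text \<open>Comparing every deletion with position \<open>0\<close> replaces the search for a common
  color by finitely many equations between colors of codes, which an oracle program can
  check.\<close>

lemma homogeneous_theta_iff:
  "homogeneous (Suc n) c (theta (Suc (Suc n)) s) \<longleftrightarrow>
    (\<forall>l<Suc (Suc n). c (theta (Suc n) (del_code n l s)) = c (theta (Suc n) (del_code n 0 s)))"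
  unfolding homogeneous_def nsets_theta by (auto simp: less_Suc_eq_le)


section \<open>Delayed parallelization\<close>

lemma homogeneous_mono: "homogeneous n c M \<Longrightarrow> N \<subseteq> M \<Longrightarrow> homogeneous n c N"
  using nsets_mono unfolding homogeneous_def by blast

lemma homogeneous_if_subsets:
  assumes hom: "\<And>A. A \<in> [X]\<^bsup>Suc n\<^esup> \<Longrightarrow> homogeneous n c A"
  shows "homogeneous n c X"
proof -
  \<comment> \<open>Induction on the number of elements of \<open>S\<close> outside
    \<open>T\<close>; both have \<open>n\<close> elements, so \<open>d = 0\<close> forces
    \<open>S = T\<close>.\<close>
  have "c S = c T" if "S \<in> [X]\<^bsup>n\<^esup>" "T \<in> [X]\<^bsup>n\<^esup>" "card (S - T) = d" for S T d
    using that
  proof (induction d arbitrary: S)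
    case 0
    then have "S = T"
      by (intro card_subset_eq) (auto simp: nsets_def)
    then show ?case
      by simp
  next
    case (Suc d)
    have fin: "finite S" "finite T" and card: "card S = n" "card T = n"
      using Suc.prems by (auto simp: nsets_def)
    obtain a where a: "a \<in> S" "a \<notin> T"
      using Suc.prems(3) by (metis DiffE card.empty ex_in_conv nat.simps(3))
    obtain b where b: "b \<in> T" "b \<notin> S"
      using a fin card by (metis card_subset_eq subsetI)
    \<comment> \<open>The exchange brings \<open>S\<close> closer to \<open>T\<close>, and
      \<open>S\<close> and \<open>S'\<close> both lie in the \<open>(n + 1)\<close>-element set
      \<open>insert b S\<close>.\<close>
    define S' where "S' = insert b (S - {a})"
    have "card S' = n"
      using a b fin card card_Suc_Diff1[OF fin(1) a(1)] by (simp add: S'_def)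
    have S': "S' \<in> [X]\<^bsup>n\<^esup>"
      using Suc.prems b \<open>card S' = n\<close> by (auto simp: nsets_def S'_def)
    have "S' - T = (S - T) - {a}"
      using b by (auto simp: S'_def)
    then have "card (S' - T) = d"
      using Suc.prems(3) a fin by simp
    then have "c S' = c T"
      using Suc.IH S' Suc.prems(2) by blast
    have "insert b S \<in> [X]\<^bsup>Suc n\<^esup>"
      using Suc.prems b by (auto simp: nsets_def)
    then have "homogeneous n c (insert b S)"
      by (rule hom)
    moreover have "S \<in> [insert b S]\<^bsup>n\<^esup>" "S' \<in> [insert b S]\<^bsup>n\<^esup>"
      using fin card \<open>card S' = n\<close> by (auto simp: nsets_def S'_def)
    ultimately have "c S = c S'"
      unfolding homogeneous_def by metis
    then show ?case
      using \<open>c S' = c T\<close> by simp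
  qed
  then show ?thesis
    unfolding homogeneous_def by metis
qed

text \<open>Finite range bounds the colors even for \<open>k = \<infinity>\<close>, so Ramsey's
  theorem for finitely many colors applies.\<close>

lemma infinite_homogeneous_subset:
  assumes "c \<in> colorings n k" "infinite X"
  shows "\<exists>Y\<subseteq>X. infinite Y \<and> homogeneous n c Y"
proof -
  have "finite (c ` [UNIV]\<^bsup>n\<^esup>)"
    using assms(1) by (simp add: colorings_def)
  then obtain s where "\<And>A. A \<in> [UNIV]\<^bsup>n\<^esup> \<Longrightarrow> c A < s"
    by (metis finite_nat_set_iff_bounded imageI)
  then have "c ` [X]\<^bsup>n\<^esup> \<subseteq> {..<s}"
    using nsets_mono[of X UNIV n] by blast
  then obtain Y t where "Y \<subseteq> X" "infinite Y" "c ` [Y]\<^bsup>n\<^esup> \<subseteq> {t}"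
    by (rule Ramsey_nsets[OF assms(2)])
  then have "homogeneous n c Y"
    unfolding homogeneous_def by (intro exI[of _ t]) blast
  with \<open>Y \<subseteq> X\<close> \<open>infinite Y\<close> show ?thesis
    by blast
qed

text \<open>One thinning per coloring handles any finite number of colorings, which is why the
  delayed coloring inspects only those up to the minimum.\<close>

lemma infinite_simultaneously_homogeneous_subset:
  assumes "\<And>j. cs j \<in> colorings n k" "infinite X"
  shows "\<exists>Y\<subseteq>X. infinite Y \<and> (\<forall>j<m::nat. homogeneous n (cs j) Y)"
proof (induction m)
  case 0
  then show ?case
    using assms(2) by auto
next
  case (Suc m)
  then obtain Y where Y: "Y \<subseteq> X" "infinite Y" "\<forall>j<m. homogeneous n (cs j) Y"
    by blast
  obtain Z where "Z \<subseteq> Y" "infinite Z" "homogeneous n (cs m) Z"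
    using infinite_homogeneous_subset[OF assms(1) Y(2)] by blast
  then show ?case
    using Y by (intro exI[of _ Z]) (auto simp: less_Suc_eq intro: homogeneous_mono)
qed

section \<open>The delayed coloring and its homogeneous sets\<close>

definition delayed_coloring :: "nat \<Rightarrow> (nat \<Rightarrow> nat set \<Rightarrow> nat) \<Rightarrow> nat set \<Rightarrow> nat" where
  "delayed_coloring n cs = (\<lambda>B\<in>[UNIV]\<^bsup>(n + 2)\<^esup>.
    of_bool (\<not> (\<forall>j\<le>Min B. homogeneous n (cs j) (B - {Min B}))))"

lemma delayed_coloring_in_colorings: "delayed_coloring n cs \<in> colorings (n + 2) 2"
proof -
  have "delayed_coloring n cs ` [UNIV]\<^bsup>(n + 2)\<^esup> \<subseteq> {0, 1}"
    by (auto simp: delayed_coloring_def)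
  then have "finite (delayed_coloring n cs ` [UNIV]\<^bsup>(n + 2)\<^esup>)"
    by (rule finite_subset) simp
  moreover have "enat 0 < 2" "enat (Suc 0) < 2"
    by (simp_all add: numeral_eq_enat)
  ultimately show ?thesis
    by (auto simp: colorings_def delayed_coloring_def of_bool_def)
qed

lemma delayed_coloring_homogeneous:
  assumes cs: "\<And>j. cs j \<in> colorings n k"
    and M: "infinite M" "homogeneous (n + 2) (delayed_coloring n cs) M"
    and m: "m \<in> M" "j \<le> m"
  shows "homogeneous n (cs j) (M \<inter> {m<..})"
proof (rule homogeneous_if_subsets)
  fix A assume A: "A \<in> [M \<inter> {m<..}]\<^bsup>Suc n\<^esup>"
  have step: "insert m A \<in> [M]\<^bsup>(n + 2)\<^esup> \<and>
      delayed_coloring n cs (insert m A) = of_bool (\<not> (\<forall>j\<le>m. homogeneous n (cs j) A))"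
    if A: "A \<in> [M \<inter> {m<..}]\<^bsup>Suc n\<^esup>" for A
  proof -
    have "m \<notin> A" "finite A"
      using A by (auto simp: nsets_def)
    then have "Min (insert m A) = m"
      using A by (intro Min_eqI) (auto simp: nsets_def)
    moreover have "insert m A \<in> [M]\<^bsup>(n + 2)\<^esup>"
      using A m(1) \<open>m \<notin> A\<close> by (auto simp: nsets_def)
    moreover from this have "insert m A \<in> [UNIV]\<^bsup>(n + 2)\<^esup>"
      by (auto simp: nsets_def)
    ultimately show ?thesis
      using \<open>m \<notin> A\<close> by (simp add: delayed_coloring_def)
  qed
  have "infinite (M \<inter> {m<..})"
    using M(1) by (auto simp: infinite_nat_iff_unbounded) (metis less_trans nat_neq_iff)
  \<comment> \<open>A set with minimum \<open>m\<close> is tested against the \<open>Suc m\<close>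
    colorings with index at most \<open>m\<close>.\<close>
  from infinite_simultaneously_homogeneous_subset[of cs n k, OF cs this, of "Suc m"]
  obtain Y where Y: "Y \<subseteq> M \<inter> {m<..}" "infinite Y" "\<forall>j<Suc m. homogeneous n (cs j) Y"
    by blast
  obtain A' where A': "A' \<subseteq> Y" "finite A'" "card A' = Suc n"
    using infinite_arbitrarily_large[OF Y(2)] by blast
  have A'_nsets: "A' \<in> [M \<inter> {m<..}]\<^bsup>Suc n\<^esup>"
    using A' Y(1) by (auto simp: nsets_def)
  have "\<forall>j\<le>m. homogeneous n (cs j) A'"
    using Y(3) A'(1) by (auto simp: less_Suc_eq_le intro: homogeneous_mono)
  then have "delayed_coloring n cs (insert m A') = 0"
    using step[OF A'_nsets] by simp
  \<comment> \<open>The set \<open>A'\<close> fixes the constant color of \<open>M\<close> as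
    \<open>0\<close>, which is then the color of \<open>insert m A\<close> too.\<close>
  then have "delayed_coloring n cs (insert m A) = 0"
    using M(2) step[OF A'_nsets] step[OF A] unfolding homogeneous_def by metis
  then show "homogeneous n (cs j) A"
    using step[OF A] m(2) by simp
qed

section \<open>Stability of the delayed coloring\<close>

lemma nsets_insert:
  assumes "i \<notin> D"
  shows "[insert i D]\<^bsup>Suc n\<^esup> = [D]\<^bsup>Suc n\<^esup> \<union> insert i ` [D]\<^bsup>n\<^esup>"
proof (intro equalityI subsetI)
  fix S assume S: "S \<in> [insert i D]\<^bsup>Suc n\<^esup>"
  show "S \<in> [D]\<^bsup>Suc n\<^esup> \<union> insert i ` [D]\<^bsup>n\<^esup>"
  proof (cases "i \<in> S")
    case True
    then have "S = insert i (S - {i})" "S - {i} \<in> [D]\<^bsup>n\<^esup>"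
      using S by (auto simp: nsets_def)
    then show ?thesis
      by blast
  qed (use S in \<open>auto simp: nsets_def\<close>)
qed (use assms in \<open>auto simp: nsets_def card_insert_if\<close>)

text \<open>Stability gives each of the finitely many \<open>n\<close>-element subsets of
  \<open>D\<close> a limit color. Once all limits are reached and \<open>i\<close> is outside
  \<open>D\<close>, homogeneity compares these limits with the colors inside \<open>D\<close>,
  independently of \<open>i\<close>.\<close>

lemma eventually_homogeneous_insert:
  assumes st: "stable (Suc n) c" and D: "finite D"
  shows "\<exists>b. \<forall>\<^sub>F i in sequentially. homogeneous (Suc n) c (insert i D) = b"
proof -
  have "\<exists>l. \<forall>\<^sub>F i in sequentially. c (insert i S) = l" if "S \<in> [D]\<^bsup>n\<^esup>" for S
  proof -
    have "S \<in> [UNIV]\<^bsup>n\<^esup>"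
      using that by (auto simp: nsets_def)
    then have "convergent (\<lambda>i. c (S \<union> {i}))"
      using st by (simp add: stable_def)
    then show ?thesis
      by (auto simp: convergent_def tendsto_discrete)
  qed
  then obtain L where L: "\<And>S. S \<in> [D]\<^bsup>n\<^esup> \<Longrightarrow> \<forall>\<^sub>F i in sequentially. c (insert i S) = L S"
    by metis
  have "finite ([D]\<^bsup>n\<^esup>)"
    using D by (rule finite_imp_finite_nsets)
  then have "\<forall>\<^sub>F i in sequentially. \<forall>S\<in>[D]\<^bsup>n\<^esup>. c (insert i S) = L S"
    using L by (simp add: eventually_ball_finite_distrib)
  moreover have "\<forall>\<^sub>F i in sequentially. i \<notin> D"
  proof -
    obtain u where "\<forall>i\<in>D. i < u"
      using D by (auto simp: finite_nat_set_iff_bounded)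
    then show ?thesis
      by (intro eventually_sequentiallyI[of u]) auto
  qed
  ultimately have "\<forall>\<^sub>F i in sequentially. homogeneous (Suc n) c (insert i D) =
      (\<exists>v. (\<forall>S\<in>[D]\<^bsup>Suc n\<^esup>. c S = v) \<and> (\<forall>S\<in>[D]\<^bsup>n\<^esup>. L S = v))"
    by eventually_elim (simp add: homogeneous_def nsets_insert ball_Un)
  then show ?thesis
    by blast
qed

text \<open>As soon as \<open>i\<close> exceeds \<open>A\<close>, the minimum stays
  \<open>m\<close>, so only the finitely many colorings with \<open>j \<le> m\<close> count, and
  their homogeneity tests settle from a common threshold on.\<close>

lemma stable_delayed_coloring:
  assumes st: "\<And>j. stable (Suc n) (cs j)"
  shows "stable (Suc n + 2) (delayed_coloring (Suc n) cs)"
  unfolding stable_def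
proof
  fix A :: "nat set" assume "A \<in> [UNIV]\<^bsup>(Suc n + 2 - 1)\<^esup>"
  then have A: "finite A" "card A = Suc (Suc n)" "A \<noteq> {}"
    by (auto simp: nsets_def)
  define m D where "m = Min A" and "D = A - {m}"
  have "finite D"
    using A by (simp add: D_def)
  then obtain b where b: "\<And>j. \<forall>\<^sub>F i in sequentially. homogeneous (Suc n) (cs j) (insert i D) = b j"
    using eventually_homogeneous_insert[OF st] by metis
  have "\<forall>\<^sub>F i in sequentially. \<forall>j\<in>{..m}. homogeneous (Suc n) (cs j) (insert i D) = b j"
    using b by (simp add: eventually_ball_finite_distrib)
  moreover have "\<forall>\<^sub>F i in sequentially. i > Max A"
    by (rule eventually_gt_at_top)
  ultimately have "\<forall>\<^sub>F i in sequentially.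
      delayed_coloring (Suc n) cs (A \<union> {i}) = of_bool (\<not> (\<forall>j\<le>m. b j))"
  proof eventually_elim
    case (elim i)
    have "\<forall>a\<in>A. a < i" and "m \<in> A"
      using elim(2) A by (simp_all add: m_def)
    then have "i \<notin> A" "m \<noteq> i"
      by auto
    have "m < i"
      using \<open>\<forall>a\<in>A. a < i\<close> \<open>m \<in> A\<close> by blast
    then have "Min (A \<union> {i}) = m"
      using A by (simp add: m_def[symmetric] order_less_imp_le)
    moreover have "A \<union> {i} - {m} = insert i D"
      using \<open>m \<noteq> i\<close> by (auto simp: D_def)
    moreover have "A \<union> {i} \<in> [UNIV]\<^bsup>(Suc n + 2)\<^esup>"
      using A \<open>i \<notin> A\<close> by (simp add: nsets_def)
    ultimately show ?case
      using elim(1) by (auto simp: delayed_coloring_def)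
  qed
  then show "convergent (\<lambda>i. delayed_coloring (Suc n) cs (A \<union> {i}))"
    unfolding convergent_def tendsto_discrete by blast
qed

section \<open>The reduction maps on names\<close>

definition delayed_name :: "nat \<Rightarrow> baire \<Rightarrow> baire" where
  "delayed_name n p s = of_bool (\<not> (\<forall>j<Suc (fst (prod_decode s)). \<forall>l<Suc (Suc n).
    p (prod_encode (j, del_code n l (del_code (Suc n) 0 s))) =
    p (prod_encode (j, del_code n 0 (del_code (Suc n) 0 s)))))"

lemma total_recursive_delayed_name: "total_recursive (delayed_name n)"
proof -
  have "recursive_pred (\<lambda>p s. \<not> (\<forall>j<Suc (fst (prod_decode s)). \<forall>l<Suc (Suc n).
    p (prod_encode (j, del_code n l (del_code (Suc n) 0 s))) =
    p (prod_encode (j, del_code n 0 (del_code (Suc n) 0 s)))))"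
    by (intro recursive_pred_not recursive_pred_all_less recursive_pred_all_const
        recursive_pred_eq total_recursive_basic total_recursive_del_code)
  also have "?this = ?thesis"
    by (simp only: recursive_pred_def delayed_name_def[abs_def])
  finally show ?thesis .
qed

text \<open>\<open>del_code (Suc n) 0 s\<close> codes the set without its minimum
  \<open>fst (prod_decode s)\<close>, so every color consulted is an entry of the name
  \<open>p\<close> of the whole sequence.\<close>

lemma delayed_name_eq:
  assumes "\<And>j t. p (prod_encode (j, t)) = cs j (theta (Suc n) t)"
  shows "delayed_name n p s = delayed_coloring (Suc n) cs (theta (Suc n + 2) s)"
proof -
  have hom: "homogeneous (Suc n) (cs j) (theta (Suc n + 2) s - {Min (theta (Suc n + 2) s)}) \<longleftrightarrow>
      (\<forall>l<Suc (Suc n). p (prod_encode (j, del_code n l (del_code (Suc n) 0 s))) =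
        p (prod_encode (j, del_code n 0 (del_code (Suc n) 0 s))))" for j
    unfolding assms add_2_eq_Suc' theta_minus_Min[symmetric] by (rule homogeneous_theta_iff)
  have "delayed_name n p s = of_bool (\<not> (\<forall>j\<le>Min (theta (Suc n + 2) s).
      homogeneous (Suc n) (cs j) (theta (Suc n + 2) s - {Min (theta (Suc n + 2) s)})))"
    unfolding hom delayed_name_def by (simp only: less_Suc_eq_le add_2_eq_Suc' Min_theta)
  then show ?thesis
    unfolding delayed_coloring_def by (simp only: restrict_apply' theta_nsets)
qed

text \<open>For the indicator of \<open>M\<close>, this cuts \<open>M\<close> off after its least
  element \<open>m\<close> with \<open>j \<le> m\<close>, without computing \<open>m\<close>: lying
  above some such element is the same as lying above the least one. The bounded search keeps the map
  total on all oracles.\<close>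

definition tails :: "baire \<Rightarrow> baire" where
  "tails q z = of_bool (q (snd (prod_decode z)) \<noteq> 0 \<and>
    (\<exists>m<snd (prod_decode z). fst (prod_decode z) \<le> m \<and> q m \<noteq> 0))"

lemma total_recursive_tails: "total_recursive tails"
proof -
  have "recursive_pred (\<lambda>q z. q (snd (prod_decode z)) \<noteq> 0 \<and>
    (\<exists>m<snd (prod_decode z). fst (prod_decode z) \<le> m \<and> q m \<noteq> 0))"
    by (intro recursive_pred_conj recursive_pred_not recursive_pred_ex_less recursive_pred_le
        recursive_pred_eq total_recursive_basic)
  also have "?this = ?thesis"
    by (simp only: recursive_pred_def tails_def[abs_def])
  finally show ?thesis .
qed

lemma tails_indicator:
  "(\<lambda>x. tails (indicator M) (prod_encode (j, x))) = indicator {x \<in> M. \<exists>m\<in>M. j \<le> m \<and> m < x}"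
  by (auto simp: tails_def indicator_def fun_eq_iff)

lemma infinite_homogeneous_tail:
  assumes cs: "\<And>j. cs j \<in> colorings n k"
    and M: "infinite M" "homogeneous (n + 2) (delayed_coloring n cs) M"
  shows "infinite {x \<in> M. \<exists>m\<in>M. j \<le> m \<and> m < x} \<and>
    homogeneous n (cs j) {x \<in> M. \<exists>m\<in>M. j \<le> m \<and> m < x}" (is "infinite ?N \<and> _")
proof -
  have "\<exists>m. m \<in> M \<and> j \<le> m"
    using M(1) by (auto simp: infinite_nat_iff_unbounded_le)
  define m where "m = (LEAST m. m \<in> M \<and> j \<le> m)"
  have m: "m \<in> M" "j \<le> m" and le: "\<And>m'. m' \<in> M \<Longrightarrow> j \<le> m' \<Longrightarrow> m \<le> m'"
    using LeastI_ex[OF \<open>\<exists>m. m \<in> M \<and> j \<le> m\<close>] by (auto simp: m_def intro: Least_le)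
  have N: "?N = M \<inter> {m<..}"
    using m le by (auto intro: order_le_less_trans)
  have "M \<subseteq> ?N \<union> {..m}"
    unfolding N by auto
  then have "infinite ?N"
    using M(1) by (meson finite_UnI finite_atMost finite_subset)
  moreover have "homogeneous n (cs j) ?N"
    unfolding N using delayed_coloring_homogeneous[OF cs M m] .
  ultimately show ?thesis
    by blast
qed

section \<open>The reduction, for a class of colorings\<close>

definition RT_on :: "((nat set \<Rightarrow> nat) \<Rightarrow> bool) \<Rightarrow> nat \<Rightarrow> enat \<Rightarrow>
    (nat set \<Rightarrow> nat, nat \<Rightarrow> nat) problem" where
  "RT_on P n k = (RT n k)\<lparr>solutions := (\<lambda>c. if P c then solutions (RT n k) c else {})\<rparr>"

lemma in_rep_RT_on: "in_rep (RT_on P n k) = coloring_rep n k"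
  and out_rep_RT_on: "out_rep (RT_on P n k) = cantor_rep"
  and solutions_RT_on: "solutions (RT_on P n k) c = (if P c \<and> c \<in> colorings n k
    then {indicator M |M. infinite M \<and> homogeneous n c M} else {})"
  by (simp_all add: RT_on_def RT_def)

text \<open>By Ramsey's theorem every coloring has a solution.\<close>

lemma problem_dom_RT_on: "problem_dom (RT_on P n k) = {c \<in> colorings n k. P c}"
  using infinite_homogeneous_subset[of _ n k UNIV]
  by (auto simp: problem_dom_def solutions_RT_on)

lemma seq_rep_eq_Some_iff:
  "seq_rep \<delta> p = Some xs \<longleftrightarrow> (\<forall>n. \<delta> (\<lambda>j. p (prod_encode (n, j))) = Some (xs n))"
proof
  assume "\<forall>n. \<delta> (\<lambda>j. p (prod_encode (n, j))) = Some (xs n)"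
  then show "seq_rep \<delta> p = Some xs"
    by (auto simp: seq_rep_def)
qed (auto simp: seq_rep_def dom_def split: if_splits)

text \<open>Trivial \<open>P\<close> and \<open>Q\<close> give the reduction for \<open>RT\<close>,
  stability on both sides the one for \<open>SRT\<close>.\<close>

lemma parallelization_RT_on_le:
  assumes PQ: "\<And>cs. (\<And>j. P (cs j)) \<Longrightarrow> Q (delayed_coloring (Suc n) cs)"
  shows "parallelization (RT_on P (Suc n) k) \<le>\<^sub>s\<^sub>W RT_on Q (Suc n + 2) 2"
  unfolding strong_weihrauch_le_def
proof (intro exI conjI allI impI)
  \<comment> \<open>The map \<open>tails\<close> sees the answer of \<open>G\<close> but not
    \<open>p\<close>, as strong reducibility demands.\<close>
  show "computable (\<lambda>q. Some (tails q))" "computable (\<lambda>p. Some (delayed_name n p))"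
    by (intro computable_total total_recursive_tails total_recursive_delayed_name)+
next
  fix G assume G: "realizes G (RT_on Q (Suc n + 2) 2)"
  show "realizes ((\<lambda>q. Some (tails q)) \<circ>\<^sub>m G \<circ>\<^sub>m (\<lambda>p. Some (delayed_name n p)))
      (parallelization (RT_on P (Suc n) k))"
    unfolding realizes_def
  proof (intro allI impI)
    fix p cs
    assume "in_rep (parallelization (RT_on P (Suc n) k)) p = Some cs \<and>
        cs \<in> problem_dom (parallelization (RT_on P (Suc n) k))"
    then have "in_rep (parallelization (RT_on P (Suc n) k)) p = Some cs"
      and "\<forall>j. cs j \<in> problem_dom (RT_on P (Suc n) k)"
      by (simp_all add: problem_dom_parallelization)
    then have p: "\<And>j t. p (prod_encode (j, t)) = cs j (theta (Suc n) t)"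
      and cs: "\<And>j. cs j \<in> colorings (Suc n) k" and P: "\<And>j. P (cs j)"
      by (auto simp: problem_dom_RT_on parallelization_def
          in_rep_RT_on seq_rep_eq_Some_iff coloring_rep_eq_Some_iff)
    let ?d = "delayed_coloring (Suc n) cs"
    have "coloring_rep (Suc n + 2) 2 (delayed_name n p) = Some ?d"
      by (subst coloring_rep_eq_Some_iff)
        (simp_all only: delayed_coloring_in_colorings delayed_name_eq[of p cs, OF p], simp_all)
    moreover have "?d \<in> problem_dom (RT_on Q (Suc n + 2) 2)"
      using PQ[of cs] P delayed_coloring_in_colorings[of "Suc n" cs]
      unfolding problem_dom_RT_on by blast
    ultimately obtain q y where "G (delayed_name n p) = Some q" "cantor_rep q = Some y"
        "y \<in> solutions (RT_on Q (Suc n + 2) 2) ?d"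
      using G unfolding realizes_def in_rep_RT_on out_rep_RT_on by blast
    \<comment> \<open>\<open>cantor_rep\<close> returns its argument, so the answer is literally the
      indicator function of \<open>M\<close>.\<close>
    then obtain M where q: "G (delayed_name n p) = Some (indicator M)"
      and M: "infinite M" "homogeneous (Suc n + 2) ?d M"
      by (auto simp: solutions_RT_on cantor_rep_def split: if_splits)
    let ?ys = "\<lambda>j. indicator {x \<in> M. \<exists>m\<in>M. j \<le> m \<and> m < x} :: nat \<Rightarrow> nat"
    have "cantor_rep (indicator N) = Some (indicator N)" for N
      by (simp add: cantor_rep_def indicator_def)
    then have "seq_rep cantor_rep (tails (indicator M)) = Some ?ys"
      by (simp add: seq_rep_eq_Some_iff tails_indicator)
    moreover have "?ys j \<in> solutions (RT_on P (Suc n) k) (cs j)" for j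
      using infinite_homogeneous_tail[OF cs M, of j] cs P by (auto simp: solutions_RT_on)
    ultimately show "\<exists>r y. ((\<lambda>q. Some (tails q)) \<circ>\<^sub>m G \<circ>\<^sub>m (\<lambda>p. Some (delayed_name n p))) p = Some r
        \<and> out_rep (parallelization (RT_on P (Suc n) k)) r = Some y
        \<and> y \<in> solutions (parallelization (RT_on P (Suc n) k)) cs"
      using q by (intro exI[of _ "tails (indicator M)"] exI[of _ ?ys])
        (simp add: parallelization_def out_rep_RT_on map_comp_def)
  qed
qed

theorem theorem3p28:
  fixes n :: nat and k :: enat
  assumes "n \<ge> 1" and "k \<ge> 1"
  shows "parallelization (RT n k) \<le>\<^sub>s\<^sub>W RT (n + 2) 2 \<and>
         parallelization (SRT n k) \<le>\<^sub>s\<^sub>W SRT (n + 2) 2"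
proof -
  obtain n' where n: "n = Suc n'"
    using assms(1) by (cases n) simp_all
  \<comment> \<open>Stated for all \<open>n\<close> and \<open>k\<close>, since both sides of each
    reduction are rewritten.\<close>
  have "RT n k = RT_on (\<lambda>_. True) n k" "SRT n k = RT_on (stable n) n k" for n k
    by (simp_all add: RT_on_def SRT_def)
  then show ?thesis
    using parallelization_RT_on_le[of "\<lambda>_. True" "\<lambda>_. True" n' k]
      parallelization_RT_on_le[of "stable n" "stable (n + 2)" n' k]
      stable_delayed_coloring[of n'] unfolding n by metis
qed

end
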